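(* Let $b\ge2$ be an integer and $c>1$ real such that $\alpha=\log_b c$ is irrational. For an integer $q\ge1$, put $a_q=\lfloor q\alpha\rfloor$, $\beta_q=\{q\alpha\}$, $t_q=b^{\beta_q}$, and define $$I_q=\left(\frac{q-t_q}{t_q-1},\frac{q+1}{t_q-1}\right),\qquad W_q=|I_q|=\frac{t_q+1}{t_q-1}.$$ Suppose $n_j=m+jq\in\mathcal S_{c,b}$ for $0\le j\le\ell-1$, and let $K_j=\lfloor F_{c,b}(n_j)\rfloor$. Then $$n_j\in I_q,\qquad K_{j+1}-K_j=a_q\qquad(1\le j\le\ell-2).$$ If $\ell\ge3$, then more precisely $$\frac{q-t_q}{t_q-1}<m+q<\frac{q+1}{t_q-1}-(\ell-3)q,$$ and hence $(\ell-3)q<W_q$. Consequently the maximal length $$\Lambda_{c,b}(q)=\sup\bigl(\{0\}\cup\{\ell:m,m+q,\ldots,m+(\ell-1)q\in\mathcal S_{c,b}\text{ for some }m\}\bigr)$$ satisfies $$\Lambda_{c,b}(q)\le2+\left\lceil\frac{W_q}{q}\right\rceil.$$ If the first term of a chain of length $\ell$ also satisfies $q\le(b-1)m-1$, then the first edge is principal as well (that is, $n_0\in I_q$ and $K_1-K_0=a_q$), and the bound on its length improves to $1+\lceil W_q/q\rceil$. Every chain with $\ell\ge4$ and $(\ell-3)q>1$ forces $$\{q\alpha\}<\log_b\left(1+\frac2{(\ell-3)q-1}\right).$$ If $\mu(\alpha)<\infty$, then for every $\nu>\mu(\alpha)$, $\Lambda_{c,b}(q)\ll_{c,b,\nu}q^{\nu-2}$.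 In particular, $\mu(\alpha)=2$ gives $\Lambda_{c,b}(q)\ll_{c,b,\varepsilon}q^\varepsilon$ for every $\varepsilon>0$. If $\alpha$ is badly approximable, then $\sup_q\Lambda_{c,b}(q)<\infty$.
   Context: $\mathcal S_{c,b}$ is the set of integers $m\ge1$ for which there is an integer $k\ge0$ with $mb^k\le c^m<(m+1)b^k$. $F_{c,b}(m)=m\log_b c-\log_b m$; for $m\in\mathcal S_{c,b}$, $\lfloor F_{c,b}(m)\rfloor$ is the corresponding $k$. $\{x\}=x-\lfloor x\rfloor$. The irrationality exponent $\mu(\xi)$ of an irrational $\xi$ is the infimum of all $\nu$ such that $|\xi-p/q|<q^{-\nu}$ holds for only finitely many rationals $p/q$. $\alpha$ is badly approximable if its continued-fraction partial quotients are bounded. *)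

theory Defs
  imports "HOL-Analysis.Analysis"
begin

definition S_set :: "real \<Rightarrow> nat \<Rightarrow> nat set" where
  "S_set c b = {m. 1 \<le> m \<and>
     (\<exists>k::nat. real m * real b ^ k \<le> c ^ m \<and> c ^ m < (real m + 1) * real b ^ k)}"

definition F_fun :: "real \<Rightarrow> nat \<Rightarrow> nat \<Rightarrow> real" where
  "F_fun c b m = real m * log (real b) c - log (real b) (real m)"

definition a_coef :: "real \<Rightarrow> nat \<Rightarrow> nat \<Rightarrow> int" where
  "a_coef c b q = \<lfloor>real q * log (real b) c\<rfloor>"

definition beta_coef :: "real \<Rightarrow> nat \<Rightarrow> nat \<Rightarrow> real" where
  "beta_coef c b q = frac (real q * log (real b) c)"

definition t_coef :: "real \<Rightarrow> nat \<Rightarrow> nat \<Rightarrow> real" where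
  "t_coef c b q = real b powr beta_coef c b q"

definition I_int :: "real \<Rightarrow> nat \<Rightarrow> nat \<Rightarrow> real set" where
  "I_int c b q =
     {(real q - t_coef c b q) / (t_coef c b q - 1) <..< (real q + 1) / (t_coef c b q - 1)}"

definition W_len :: "real \<Rightarrow> nat \<Rightarrow> nat \<Rightarrow> real" where
  "W_len c b q = measure lborel (I_int c b q)"

definition is_chain :: "real \<Rightarrow> nat \<Rightarrow> nat \<Rightarrow> nat \<Rightarrow> nat \<Rightarrow> bool" where
  "is_chain c b q m l \<longleftrightarrow> (\<forall>j<l. m + j * q \<in> S_set c b)"

(* The supremum is taken in enat, so that it is infinity if chains of common difference q
   are arbitrarily long. *)
definition max_chain :: "real \<Rightarrow> nat \<Rightarrow> nat \<Rightarrow> enat" where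
  "max_chain c b q = Sup ({0} \<union> {enat l | l. \<exists>m. is_chain c b q m l})"

(* Rationals p/q are represented by coprime pairs with q >= 1; the infimum of the empty set
   is infinity. *)
definition irrationality_exponent :: "real \<Rightarrow> ereal" where
  "irrationality_exponent \<xi> = Inf {ereal \<nu> | \<nu>.
     finite {(p :: int, q :: nat). 1 \<le> q \<and> coprime p (int q) \<and>
               \<bar>\<xi> - real_of_int p / real q\<bar> < real q powr (- \<nu>)}}"

(* For irrational arguments the fractional parts below never vanish. *)
primrec complete_quotient :: "real \<Rightarrow> nat \<Rightarrow> real" where
  "complete_quotient \<xi> 0 = \<xi>"
| "complete_quotient \<xi> (Suc n) = 1 / frac (complete_quotient \<xi> n)"

definition partial_quotient :: "real \<Rightarrow> nat \<Rightarrow> int" where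
  "partial_quotient \<xi> n = \<lfloor>complete_quotient \<xi> n\<rfloor>"

definition badly_approximable :: "real \<Rightarrow> bool" where
  "badly_approximable \<xi> \<longleftrightarrow> \<xi> \<notin> \<rat> \<and> (\<exists>B. \<forall>n. partial_quotient \<xi> n \<le> B)"

end

theory Submission
  imports Defs
begin

text \<open>
  Write \<open>\<alpha>\<close> for the logarithm of \<open>c\<close> to the base \<open>b\<close>, so that \<open>c ^ q = b ^ a * t\<close> with \<open>a\<close> the
  integer part of \<open>q * \<alpha>\<close> and \<open>1 < t < b\<close>. A number \<open>n\<close> lies in \<open>S\<close> with exponent \<open>K\<close> exactly when
  \<open>c ^ n / b ^ K\<close> lies in \<open>[n, n + 1)\<close>. If \<open>n\<close> and \<open>n + q\<close> both do, with exponents \<open>K\<close> and \<open>L\<close>,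
  division shows that \<open>t * b ^ (a - (L - K))\<close> lies strictly between \<open>(n + q) / (n + 1)\<close> and
  \<open>(n + q + 1) / n\<close>. As \<open>1 < t < b\<close>, the first bound forces \<open>L - K \<le> a\<close>, and the second
  forces equality as soon as \<open>n + q + 1 \<le> b * n\<close>. Then the two bounds on \<open>t\<close> say precisely that
  \<open>n\<close> lies in the interval \<open>I\<close> (\<open>principal_edge\<close>). After the first term of a chain the
  size condition is automatic, because there \<open>n > q\<close>. All terms but the first and the last
  are therefore points of \<open>I\<close> with spacing \<open>q\<close>, and comparison with the length \<open>W\<close> of \<open>I\<close> gives
  all the explicit bounds.

  Since \<open>W = (t + 1) / (t - 1)\<close> and \<open>t - 1 \<ge> ln b * frac (q * \<alpha>)\<close>, the maximal length is
  at most \<open>3 + M / (q * frac (q * \<alpha>))\<close> with \<open>M\<close> depending on \<open>b\<close> only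
  (\<open>max_chain_le_inverse_frac\<close>). The asymptotic statements thus reduce to lower bounds for
  \<open>q * frac (q * \<alpha>)\<close>. One of order \<open>q powr (2 - \<nu>)\<close> comes from the irrationality exponent
  (\<open>irrationality_exponent_imp_lower_bound\<close>); the constant \<open>3\<close> is absorbed because \<open>\<nu> > 2\<close>, which is
  Dirichlet's theorem. A constant one comes from bounded partial quotients, by
  following the pair \<open>(q, p)\<close> through the continued fraction algorithm
  (\<open>Gauss_map_orbit_lower_bound\<close>).
\<close>

section \<open>Edges and chains\<close>

locale irrational_log =
  fixes b :: nat and c :: real
  assumes b_ge_2: "2 \<le> b" and c_gt_1: "1 < c" and irrational: "log (real b) c \<notin> \<rat>"
begin

lemma multiple_not_Ints:
  assumes "1 \<le> q"
  shows "real q * log (real b) c \<notin> \<int>"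
proof
  assume "real q * log (real b) c \<in> \<int>"
  then have "real q * log (real b) c / real q \<in> \<rat>"
    by (intro Rats_divide) (auto elim: Ints_cases)
  with assms irrational show False by simp
qed

lemma beta_coef_bounds:
  assumes "1 \<le> q"
  shows "0 < beta_coef c b q" "beta_coef c b q < 1"
  using multiple_not_Ints[OF assms] by (simp_all add: beta_coef_def frac_lt_1)

lemma t_coef_bounds:
  assumes "1 \<le> q"
  shows "1 < t_coef c b q" "t_coef c b q < real b"
proof -
  show "1 < t_coef c b q"
    using beta_coef_bounds[OF assms] b_ge_2 by (simp add: t_coef_def)
  have "real b powr beta_coef c b q < real b powr 1"
    using beta_coef_bounds[OF assms] b_ge_2 by (intro powr_less_mono) auto
  then show "t_coef c b q < real b"
    using b_ge_2 by (simp add: t_coef_def)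
qed

lemma a_coef_nonneg: "0 \<le> a_coef c b q"
  using b_ge_2 c_gt_1 by (simp add: a_coef_def)

lemma power_eq_t_coef:
  "c ^ q = real b ^ nat (a_coef c b q) * t_coef c b q"
proof -
  have "c ^ q = c powr real q"
    using c_gt_1 by (simp add: powr_realpow)
  also have "\<dots> = (real b powr log (real b) c) powr real q"
    using b_ge_2 c_gt_1 by simp
  also have "\<dots> = real b powr (real_of_int (a_coef c b q) + beta_coef c b q)"
    by (simp add: powr_powr a_coef_def beta_coef_def frac_def mult.commute)
  also have "\<dots> = real b powr real (nat (a_coef c b q)) * t_coef c b q"
    using a_coef_nonneg[of q] by (simp add: powr_add t_coef_def)
  finally show ?thesis
    using b_ge_2 by (simp add: powr_realpow)
qed

lemma W_len_eq:
  assumes "1 \<le> q"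
  shows "W_len c b q = (t_coef c b q + 1) / (t_coef c b q - 1)"
proof -
  have "(real q - t_coef c b q) / (t_coef c b q - 1) \<le> (real q + 1) / (t_coef c b q - 1)"
    using t_coef_bounds[OF assms] by (intro divide_right_mono) auto
  then show ?thesis
    by (simp add: W_len_def I_int_def diff_divide_distrib[symmetric])
qed

lemma W_len_pos:
  assumes "1 \<le> q"
  shows "0 < W_len c b q"
  using t_coef_bounds[OF assms] by (simp add: W_len_eq[OF assms])

lemma I_int_spread:
  assumes "1 \<le> q" "x \<in> I_int c b q" "y \<in> I_int c b q"
  shows "y - x < W_len c b q"
proof -
  have "W_len c b q
      = (real q + 1) / (t_coef c b q - 1) - (real q - t_coef c b q) / (t_coef c b q - 1)"
    by (simp add: W_len_eq[OF assms(1)] diff_divide_distrib[symmetric])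
  then show ?thesis using assms(2,3) by (simp add: I_int_def)
qed

text \<open>
  The exponent that witnesses membership is the floor of \<open>F\<close> because \<open>n + 1 \<le> b * n\<close>: the
  window \<open>[n, n + 1)\<close> is contained in \<open>[n, b * n)\<close>.
\<close>

lemma S_set_floor:
  assumes "n \<in> S_set c b"
  obtains K where "\<lfloor>F_fun c b n\<rfloor> = int K"
    "real n * real b ^ K \<le> c ^ n" "c ^ n < (real n + 1) * real b ^ K"
proof -
  obtain K where n: "1 \<le> n" and lo: "real n * real b ^ K \<le> c ^ n"
    and hi: "c ^ n < (real n + 1) * real b ^ K"
    using assms by (auto simp: S_set_def)
  have b1: "1 < real b" using b_ge_2 by simp
  have "log (real b) (real n * real b ^ K) \<le> log (real b) (c ^ n)"
    using b1 lo n c_gt_1 by (subst log_le_cancel_iff) auto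
  then have "real K \<le> F_fun c b n"
    using b1 n c_gt_1 by (simp add: F_fun_def log_mult log_nat_power)
  have "(real n + 1) * real b ^ K \<le> (real n * real b) * real b ^ K"
  proof (intro mult_right_mono)
    have "real n * 2 \<le> real n * real b" using b_ge_2 by (intro mult_left_mono) auto
    moreover have "1 \<le> real n" using n by simp
    ultimately show "real n + 1 \<le> real n * real b" by linarith
  qed simp
  with hi have "c ^ n < real n * real b ^ Suc K" by (simp add: mult.assoc)
  then have "log (real b) (c ^ n) < log (real b) (real n * real b ^ Suc K)"
    using b1 n c_gt_1 by (subst log_less_cancel_iff) auto
  then have "F_fun c b n < real K + 1"
    using b1 n c_gt_1 by (simp add: F_fun_def log_mult log_nat_power del: power_Suc)
  with \<open>real K \<le> F_fun c b n\<close> have "\<lfloor>F_fun c b n\<rfloor> = int K"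
    by (simp add: floor_eq_iff)
  with lo hi that show thesis by blast
qed

text \<open>
  Dividing the two windows, \<open>t * b ^ (K + A - L)\<close> lies between \<open>(n + q) / (n + 1) \<ge> 1\<close> and
  \<open>(n + q + 1) / n \<le> b\<close>, while \<open>1 < t < b\<close>. So the exponent vanishes, and what remains
  are the two inequalities that define the interval.
\<close>

lemma principal_edge:
  assumes q: "1 \<le> q" and n: "n \<in> S_set c b" and nq: "n + q \<in> S_set c b"
    and large: "n + q + 1 \<le> b * n"
  shows "real n \<in> I_int c b q"
    and "\<lfloor>F_fun c b (n + q)\<rfloor> - \<lfloor>F_fun c b n\<rfloor> = a_coef c b q"
proof -
  obtain K where K: "\<lfloor>F_fun c b n\<rfloor> = int K"
    and Klo: "real n * real b ^ K \<le> c ^ n" and Khi: "c ^ n < (real n + 1) * real b ^ K"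
    using S_set_floor[OF n] by blast
  obtain L where L: "\<lfloor>F_fun c b (n + q)\<rfloor> = int L"
    and Llo: "real (n + q) * real b ^ L \<le> c ^ (n + q)"
    and Lhi: "c ^ (n + q) < (real (n + q) + 1) * real b ^ L"
    using S_set_floor[OF nq] by blast
  define t where "t = t_coef c b q"
  define A where "A = nat (a_coef c b q)"
  have t: "1 < t" "t < real b" using t_coef_bounds[OF q] by (simp_all add: t_def)
  have b1: "1 < real b" using b_ge_2 by simp
  have n1: "1 \<le> n" using n by (simp add: S_set_def)
  have cq: "c ^ q = real b ^ A * t" by (simp add: A_def t_def power_eq_t_coef)
  have cq0: "0 < c ^ q" using c_gt_1 by simp
  have lower: "real (n + q) * real b ^ L < (real n + 1) * t * real b ^ (K + A)"
  proof -
    have "c ^ n * c ^ q < (real n + 1) * real b ^ K * c ^ q"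
      using Khi cq0 by (intro mult_strict_right_mono)
    with Llo show ?thesis by (simp add: power_add cq mult_ac)
  qed
  have upper: "real n * t * real b ^ (K + A) < (real (n + q) + 1) * real b ^ L"
  proof -
    have "real n * real b ^ K * c ^ q \<le> c ^ n * c ^ q"
      using Klo cq0 by (intro mult_right_mono) auto
    with Lhi show ?thesis by (simp add: power_add cq mult_ac)
  qed
  have "L < Suc (K + A)"
  proof -
    have "(real n + 1) * real b ^ L \<le> real (n + q) * real b ^ L"
      using q by (intro mult_right_mono) auto
    also note lower
    also have "(real n + 1) * t * real b ^ (K + A) \<le> (real n + 1) * real b * real b ^ (K + A)"
      using t by (intro mult_right_mono mult_left_mono) auto
    finally have "(real n + 1) * real b ^ L < (real n + 1) * real b ^ Suc (K + A)"
      by (simp only: power_Suc mult.assoc)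
    then have "real b ^ L < real b ^ Suc (K + A)"
      by (subst (asm) mult_less_cancel_left_pos) auto
    then show ?thesis using b1 by (simp only: power_strict_increasing_iff)
  qed
  moreover have "K + A < Suc L"
  proof -
    have "real n * real b ^ (K + A) \<le> real n * t * real b ^ (K + A)"
      using t n1 by (intro mult_right_mono) auto
    also note upper
    also have "(real (n + q) + 1) * real b ^ L \<le> (real b * real n) * real b ^ L"
    proof (intro mult_right_mono)
      have "real (n + q + 1) \<le> real (b * n)" using large by (simp only: of_nat_le_iff)
      then show "real (n + q) + 1 \<le> real b * real n" by simp
    qed simp
    finally have "real n * real b ^ (K + A) < real n * real b ^ Suc L"
      by (simp only: power_Suc mult_ac)
    then have "real b ^ (K + A) < real b ^ Suc L"
      using n1 by (subst (asm) mult_less_cancel_left_pos) auto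
    then show ?thesis using b1 by (simp only: power_strict_increasing_iff)
  qed
  ultimately have LK: "L = K + A" by simp
  show "\<lfloor>F_fun c b (n + q)\<rfloor> - \<lfloor>F_fun c b n\<rfloor> = a_coef c b q"
    using a_coef_nonneg[of q] by (simp add: K L LK A_def)
  have pos: "0 < real b ^ (K + A)" using b1 by simp
  have "real (n + q) < (real n + 1) * t"
    using lower pos unfolding LK by (simp only: mult_less_cancel_right_pos)
  moreover have "real n * t < real (n + q) + 1"
    using upper pos unfolding LK by (simp only: mult_less_cancel_right_pos)
  ultimately show "real n \<in> I_int c b q"
    using t by (simp add: I_int_def t_def[symmetric] divide_less_eq less_divide_eq algebra_simps)
qed

text \<open>
  From the second term on, \<open>n \<ge> q + 1\<close>, hence \<open>n + q + 1 \<le> 2 * n \<le> b * n\<close>.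
\<close>

lemma later_edge_principal:
  assumes q: "1 \<le> q" and ch: "is_chain c b q m l" and j: "1 \<le> j" "j + 2 \<le> l"
  shows "real (m + j * q) \<in> I_int c b q"
    and "\<lfloor>F_fun c b (m + (j + 1) * q)\<rfloor> - \<lfloor>F_fun c b (m + j * q)\<rfloor> = a_coef c b q"
proof -
  have "0 < l" using j by simp
  then have "m \<in> S_set c b" using ch by (force simp: is_chain_def)
  then have m: "1 \<le> m" by (simp add: S_set_def)
  have "m + j * q \<in> S_set c b" "m + (j + 1) * q \<in> S_set c b"
    using ch j by (auto simp only: is_chain_def)
  then have S: "m + j * q \<in> S_set c b" "(m + j * q) + q \<in> S_set c b"
    by (simp_all add: algebra_simps)
  have "1 * q \<le> j * q" using j by (intro mult_le_mono1)
  moreover have "m + z + q + 1 \<le> 2 * (m + z)" if "1 * q \<le> z" for z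
    using that m by simp
  ultimately have "(m + j * q) + q + 1 \<le> 2 * (m + j * q)" by blast
  also have "\<dots> \<le> b * (m + j * q)" using b_ge_2 by (intro mult_le_mono1)
  finally have large: "(m + j * q) + q + 1 \<le> b * (m + j * q)" .
  show "real (m + j * q) \<in> I_int c b q" by (rule principal_edge(1)[OF q S large])
  show "\<lfloor>F_fun c b (m + (j + 1) * q)\<rfloor> - \<lfloor>F_fun c b (m + j * q)\<rfloor> = a_coef c b q"
    using principal_edge(2)[OF q S large] by (simp add: algebra_simps)
qed

lemma first_edge_principal:
  assumes q: "1 \<le> q" and ch: "is_chain c b q m l" and l: "2 \<le> l"
    and large: "int q \<le> (int b - 1) * int m - 1"
  shows "real m \<in> I_int c b q"
    and "\<lfloor>F_fun c b (m + q)\<rfloor> - \<lfloor>F_fun c b m\<rfloor> = a_coef c b q"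
proof -
  have "m + 0 * q \<in> S_set c b" "m + 1 * q \<in> S_set c b"
    using ch l by (auto simp only: is_chain_def)
  then have S: "m \<in> S_set c b" "m + q \<in> S_set c b" by simp_all
  have "int (m + q + 1) \<le> int (b * m)" using large by (simp add: algebra_simps)
  then have large': "m + q + 1 \<le> b * m" by (simp only: of_nat_le_iff)
  show "real m \<in> I_int c b q"
    and "\<lfloor>F_fun c b (m + q)\<rfloor> - \<lfloor>F_fun c b m\<rfloor> = a_coef c b q"
    by (rule principal_edge[OF q S large'])+
qed

text \<open>
  The second term \<open>m + q\<close> and the last but one \<open>m + (l - 2) * q\<close> both lie in the interval, and they
  differ by \<open>(l - 3) * q\<close>.
\<close>

lemma chain_position:
  assumes q: "1 \<le> q" and ch: "is_chain c b q m l" and l: "3 \<le> l"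
  shows "(real q - t_coef c b q) / (t_coef c b q - 1) < real m + real q"
    and "real m + real q < (real q + 1) / (t_coef c b q - 1) - (real l - 3) * real q"
    and "(real l - 3) * real q < W_len c b q"
proof -
  have i: "real (m + 1 * q) \<in> I_int c b q" "real (m + (l - 2) * q) \<in> I_int c b q"
    using l by (intro later_edge_principal(1)[OF q ch]; simp)+
  have e: "real (m + (l - 2) * q) = real m + real q + (real l - 3) * real q"
    using l by (simp add: of_nat_diff left_diff_distrib)
  show "(real q - t_coef c b q) / (t_coef c b q - 1) < real m + real q"
    using i(1) by (simp add: I_int_def)
  show "real m + real q < (real q + 1) / (t_coef c b q - 1) - (real l - 3) * real q"
    using i(2) unfolding e by (simp add: I_int_def)
  show "(real l - 3) * real q < W_len c b q"
    using I_int_spread[OF q i] unfolding e by simp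
qed

lemma ceiling_W_len_pos:
  assumes "1 \<le> q"
  shows "1 \<le> \<lceil>W_len c b q / real q\<rceil>"
  using W_len_pos[OF assms] assms by (simp add: one_le_ceiling)

lemma chain_length_le:
  assumes q: "1 \<le> q" and ch: "is_chain c b q m l"
  shows "int l \<le> 2 + \<lceil>W_len c b q / real q\<rceil>"
proof (cases "3 \<le> l")
  case True
  have "real l - 3 < W_len c b q / real q"
    using chain_position(3)[OF q ch True] q by (simp add: less_divide_eq)
  then have "real_of_int (int l - 3) < real_of_int \<lceil>W_len c b q / real q\<rceil>"
    using le_of_int_ceiling[of "W_len c b q / real q"]
    by (simp only: of_int_diff of_int_of_nat_eq of_int_numeral)
  then show ?thesis by linarith
next
  case False
  then show ?thesis using ceiling_W_len_pos[OF q] by linarith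
qed

text \<open>
  Here the first term lies in the interval as well, so the span inside it grows to
  \<open>(l - 2) * q\<close>.
\<close>

lemma chain_length_le_of_first_edge:
  assumes q: "1 \<le> q" and ch: "is_chain c b q m l"
    and large: "int q \<le> (int b - 1) * int m - 1"
  shows "int l \<le> 1 + \<lceil>W_len c b q / real q\<rceil>"
proof (cases "3 \<le> l")
  case True
  have "real (m + (l - 2) * q) - real m < W_len c b q"
    using True by (intro I_int_spread[OF q] first_edge_principal(1)[OF q ch _ large]
        later_edge_principal(1)[OF q ch]) auto
  then have "(real l - 2) * real q < W_len c b q"
    using True by (simp add: of_nat_diff)
  then have "real l - 2 < W_len c b q / real q"
    using q by (simp add: less_divide_eq)
  then have "real_of_int (int l - 2) < real_of_int \<lceil>W_len c b q / real q\<rceil>"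
    using le_of_int_ceiling[of "W_len c b q / real q"]
    by (simp only: of_int_diff of_int_of_nat_eq of_int_numeral)
  then show ?thesis by linarith
next
  case False
  then show ?thesis using ceiling_W_len_pos[OF q] by linarith
qed

text \<open>
  Solving \<open>X < (t + 1) / (t - 1)\<close> for \<open>t\<close> gives \<open>t < 1 + 2 / (X - 1)\<close>; the fractional part is the
  logarithm of \<open>t\<close>.
\<close>

lemma long_chain_forces_small_frac:
  assumes q: "1 \<le> q" and ch: "is_chain c b q m l" and l: "4 \<le> l" "1 < (real l - 3) * real q"
  shows "frac (real q * log (real b) c) < log (real b) (1 + 2 / ((real l - 3) * real q - 1))"
proof -
  define X where "X = (real l - 3) * real q"
  define t where "t = t_coef c b q"
  have t: "1 < t" using t_coef_bounds[OF q] by (simp add: t_def)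
  have X: "1 < X" using l by (simp add: X_def)
  have "X < (t + 1) / (t - 1)"
    using chain_position(3)[OF q ch] l(1) by (simp add: W_len_eq[OF q] X_def t_def)
  then have "X * (t - 1) < t + 1" using t by (simp add: less_divide_eq)
  then have "t < 1 + 2 / (X - 1)" using X by (simp add: field_simps)
  then have "log (real b) t < log (real b) (1 + 2 / (X - 1))"
    using t b_ge_2 by (subst log_less_cancel_iff) (auto intro: less_trans)
  moreover have "log (real b) t = frac (real q * log (real b) c)"
    using b_ge_2 by (simp add: t_def t_coef_def beta_coef_def log_powr)
  ultimately show ?thesis by (simp add: X_def)
qed

lemma max_chain_le:
  assumes q: "1 \<le> q"
  shows "max_chain c b q \<le> enat (nat (2 + \<lceil>W_len c b q / real q\<rceil>))"
  unfolding max_chain_def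
proof (rule Sup_least)
  fix x
  assume "x \<in> {0} \<union> {enat l |l. \<exists>m. is_chain c b q m l}"
  then show "x \<le> enat (nat (2 + \<lceil>W_len c b q / real q\<rceil>))"
    using chain_length_le[OF q] by (force simp: zero_enat_def nat_le_iff le_nat_iff)
qed

lemma max_chain_le_ceiling:
  assumes q: "1 \<le> q"
  shows "ereal_of_enat (max_chain c b q) \<le> ereal (2 + real_of_int \<lceil>W_len c b q / real q\<rceil>)"
proof -
  have "ereal_of_enat (max_chain c b q)
      \<le> ereal_of_enat (enat (nat (2 + \<lceil>W_len c b q / real q\<rceil>)))"
    using max_chain_le[OF q] by (simp only: ereal_of_enat_le_iff)
  also have "\<dots> = ereal (2 + real_of_int \<lceil>W_len c b q / real q\<rceil>)"
    using ceiling_W_len_pos[OF q] by simp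
  finally show ?thesis .
qed

text \<open>
  This separates the combinatorics of chains from Diophantine approximation: the
  only input about \<open>c\<close> that remains is the size of \<open>q * frac (q * \<alpha>)\<close>. The estimate is
  \<open>t - 1 = exp (\<beta> * ln b) - 1 \<ge> \<beta> * ln b\<close> together with \<open>t + 1 \<le> b + 1\<close>.
\<close>

lemma max_chain_le_inverse_frac:
  assumes q: "1 \<le> q"
  shows "ereal_of_enat (max_chain c b q) \<le>
    ereal (3 + (real b + 1) / ln (real b) / (real q * frac (real q * log (real b) c)))"
proof -
  define \<beta> where "\<beta> = beta_coef c b q"
  define t where "t = t_coef c b q"
  have \<beta>: "0 < \<beta>" using beta_coef_bounds[OF q] by (simp add: \<beta>_def)
  have lnb: "0 < ln (real b)" using b_ge_2 by simp
  have t: "1 < t" "t < real b" using t_coef_bounds[OF q] by (simp_all add: t_def)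
  have "t = exp (\<beta> * ln (real b))"
    using b_ge_2 by (simp add: t_def t_coef_def \<beta>_def powr_def)
  then have "\<beta> * ln (real b) \<le> t - 1"
    using exp_ge_add_one_self[of "\<beta> * ln (real b)"] by linarith
  then have "(t + 1) / (t - 1) \<le> (real b + 1) / (\<beta> * ln (real b))"
    using t \<beta> lnb by (intro frac_le) auto
  then have "W_len c b q / real q \<le> (real b + 1) / (\<beta> * ln (real b)) / real q"
    by (intro divide_right_mono) (simp_all add: W_len_eq[OF q] t_def)
  also have "\<dots> = (real b + 1) / ln (real b) / (real q * \<beta>)"
    by (simp add: mult_ac)
  finally have "2 + real_of_int \<lceil>W_len c b q / real q\<rceil>
      \<le> 3 + (real b + 1) / ln (real b) / (real q * \<beta>)"
    using ceiling_correct[of "W_len c b q / real q"] by linarith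
  with max_chain_le_ceiling[OF q] show ?thesis
    unfolding \<beta>_def beta_coef_def by (meson ereal_less_eq(3) order_trans)
qed

end

section \<open>Irrationality exponents\<close>

text \<open>
  By Dirichlet, an irrational number has infinitely many reduced fractions within
  \<open>1 / q^2\<close>, and for \<open>\<nu> < 2\<close> these all satisfy the weaker condition with exponent \<open>\<nu>\<close>.
\<close>

lemma irrationality_exponent_ge_2:
  assumes "\<xi> \<notin> \<rat>"
  shows "2 \<le> irrationality_exponent \<xi>"
  unfolding irrationality_exponent_def
proof (rule Inf_greatest)
  fix x
  assume "x \<in> {ereal \<nu> | \<nu>. finite {(p :: int, q :: nat). 1 \<le> q \<and> coprime p (int q) \<and>
               \<bar>\<xi> - real_of_int p / real q\<bar> < real q powr (- \<nu>)}}"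
  then obtain \<nu> where x: "x = ereal \<nu>"
    and fin: "finite {(p :: int, q :: nat). 1 \<le> q \<and> coprime p (int q) \<and>
               \<bar>\<xi> - real_of_int p / real q\<bar> < real q powr (- \<nu>)}" (is "finite ?A")
    by blast
  have "2 \<le> \<nu>"
  proof (rule ccontr)
    assume "\<not> 2 \<le> \<nu>"
    have "approx_set \<xi> \<subseteq> (\<lambda>(p, q). (p, int q)) ` ?A"
    proof
      fix z
      assume "z \<in> approx_set \<xi>"
      then obtain h k where z: "z = (h, k)" and k: "0 < k" and cop: "coprime h k"
        and close: "\<bar>\<xi> - real_of_int h / real_of_int k\<bar> < 1 / (real_of_int k)\<^sup>2"
        by (auto simp: approx_set_def)
      have "1 / (real_of_int k)\<^sup>2 = real_of_int k powr (- 2)"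
        using k by (simp add: powr_minus_divide powr_numeral)
      also have "\<dots> \<le> real_of_int k powr (- \<nu>)"
        using k \<open>\<not> 2 \<le> \<nu>\<close> by (intro powr_mono) auto
      finally have "(h, nat k) \<in> ?A"
        using k cop close by auto
      then show "z \<in> (\<lambda>(p, q). (p, int q)) ` ?A"
        using k by (force simp: z)
    qed
    with fin have "finite (approx_set \<xi>)" by (meson finite_imageI finite_subset)
    with assms show False by (simp add: rational_iff_finite_approx_set)
  qed
  then show "2 \<le> x" by (simp add: x)
qed

text \<open>
  For some \<open>\<nu>' < \<nu>\<close> only finitely many reduced fractions are closer than \<open>q powr (- \<nu>')\<close>; the least
  of \<open>1\<close> and their distances, which are positive, serves as constant. Other fractions reduce to
  coprime ones with a smaller denominator, where the bound is stronger because \<open>\<nu> > 0\<close>.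
\<close>

lemma irrationality_exponent_imp_lower_bound:
  assumes irr: "\<xi> \<notin> \<rat>" and \<nu>: "irrationality_exponent \<xi> < ereal \<nu>"
  obtains \<delta> where "0 < \<delta>"
    "\<And>p q. 1 \<le> q \<Longrightarrow> \<delta> * real q powr (- \<nu>) \<le> \<bar>\<xi> - real_of_int p / real q\<bar>"
proof -
  obtain \<nu>' where less: "\<nu>' < \<nu>"
    and fin: "finite {(p :: int, q :: nat). 1 \<le> q \<and> coprime p (int q) \<and>
               \<bar>\<xi> - real_of_int p / real q\<bar> < real q powr (- \<nu>')}" (is "finite ?A")
    using \<nu> unfolding irrationality_exponent_def Inf_less_iff by auto
  have "2 < ereal \<nu>"
    using irrationality_exponent_ge_2[OF irr] \<nu> by (rule le_less_trans)
  then have \<nu>0: "0 < \<nu>" by simp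
  define D where "D = (\<lambda>(p, q). \<bar>\<xi> - real_of_int p / real q\<bar>) ` ?A"
  define \<delta> where "\<delta> = Min (insert 1 D)"
  have finD: "finite D" using fin by (simp add: D_def)
  have nz: "0 < \<bar>\<xi> - real_of_int p / real q\<bar>" for p :: int and q :: nat
    using irr by (metis Rats_divide Rats_of_int Rats_of_nat eq_iff_diff_eq_0 zero_less_abs_iff)
  have "0 < x" if "x \<in> insert 1 D" for x
    using that nz by (auto simp: D_def)
  then have "0 < \<delta>" using finD by (auto simp: \<delta>_def)
  have "\<delta> \<le> 1" using finD by (simp add: \<delta>_def)
  have coprime_bound: "\<delta> * real q powr (- \<nu>) \<le> \<bar>\<xi> - real_of_int p / real q\<bar>"
    if q: "1 \<le> q" and cop: "coprime p (int q)" for p q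
  proof (cases "(p, q) \<in> ?A")
    case True
    then have "\<bar>\<xi> - real_of_int p / real q\<bar> \<in> D" by (force simp: D_def)
    then have "\<delta> \<le> \<bar>\<xi> - real_of_int p / real q\<bar>" using finD by (simp add: \<delta>_def)
    moreover have "real q powr (- \<nu>) \<le> real q powr 0"
      using q \<nu>0 by (intro powr_mono) auto
    then have "\<delta> * real q powr (- \<nu>) \<le> \<delta> * 1"
      using q \<open>0 < \<delta>\<close> by (intro mult_left_mono) auto
    ultimately show ?thesis by simp
  next
    case False
    then have "real q powr (- \<nu>') \<le> \<bar>\<xi> - real_of_int p / real q\<bar>"
      using q cop by auto
    moreover have "real q powr (- \<nu>) \<le> real q powr (- \<nu>')"
      using q less by (intro powr_mono) auto
    moreover have "\<delta> * real q powr (- \<nu>) \<le> 1 * real q powr (- \<nu>)"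
      using \<open>\<delta> \<le> 1\<close> by (intro mult_right_mono) auto
    ultimately show ?thesis by simp
  qed
  have "\<delta> * real q powr (- \<nu>) \<le> \<bar>\<xi> - real_of_int p / real q\<bar>" if q: "1 \<le> q" for p q
  proof -
    define g where "g = gcd p (int q)"
    define p' where "p' = p div g"
    define q' where "q' = nat (int q div g)"
    have g: "0 < g" using q by (simp add: g_def)
    have p: "p = p' * g" by (simp add: p'_def g_def)
    have "int q div g * g = int q" by (simp add: g_def)
    moreover have "0 \<le> int q div g" using g by (simp add: pos_imp_zdiv_nonneg_iff)
    ultimately have q'g: "int q = int q' * g" by (simp add: q'_def)
    have cop: "coprime p' (int q')"
      using q g \<open>0 \<le> int q div g\<close> unfolding p'_def q'_def g_def
      by (simp add: div_gcd_coprime)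
    have q'1: "1 \<le> q'" using q q'g by (cases q') auto
    have "int q' * 1 \<le> int q" unfolding q'g using g by (intro mult_left_mono) auto
    then have "q' \<le> q" by simp
    have rq: "real q = real q' * real_of_int g"
      using q'g by (metis of_int_mult of_int_of_nat_eq)
    have "real_of_int p / real q = real_of_int p' / real q'"
      using g by (simp add: p rq)
    moreover have "real q powr (- \<nu>) \<le> real q' powr (- \<nu>)"
      using q'1 \<open>q' \<le> q\<close> \<nu>0 by (intro powr_mono2') auto
    then have "\<delta> * real q powr (- \<nu>) \<le> \<delta> * real q' powr (- \<nu>)"
      using \<open>0 < \<delta>\<close> by (intro mult_left_mono) auto
    ultimately show ?thesis using coprime_bound[OF q'1 cop] by simp
  qed
  with \<open>0 < \<delta>\<close> that show thesis by blast
qed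

section \<open>Bounded partial quotients\<close>

text \<open>
  The sequence \<open>x\<close> is an orbit of the Gauss map and \<open>a\<close> is its sequence of digits. One step of the
  continued fraction algorithm sends \<open>(q, p)\<close> to \<open>(p, q - a * p)\<close>, and \<open>x\<close> to \<open>1 / x - a\<close>. The
  product \<open>q * \<bar>q * x - p\<bar>\<close> is not preserved by this step, so a bound for it alone does not pass
  through the induction. What is preserved is the absolute value at \<open>(q, p)\<close> of the indefinite
  quadratic form with roots \<open>x\<close> and \<open>- 1 / \<theta>\<close>, divided by the square root of its discriminant:
  \<open>\<bar>q * x - p\<bar> * (q + \<theta> * p) / (1 + x * \<theta>)\<close>, provided that \<open>\<theta>\<close> is replaced by
  \<open>1 / (a + \<theta>)\<close>. Here \<open>\<theta>\<close> records the digits already consumed; \<open>\<theta> = 0\<close> gives back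
  \<open>q * \<bar>q * x - p\<bar>\<close>.

  The step is made while \<open>0 < p < q\<close> and \<open>a * p \<le> q\<close>. Otherwise \<open>p / q\<close> is far from \<open>x\<close> for elementary
  reasons, as \<open>x\<close> stays away from \<open>0\<close> and \<open>1\<close> when the digits are bounded.
\<close>

lemma Gauss_map_orbit_lower_bound:
  fixes x :: "nat \<Rightarrow> real" and a :: "nat \<Rightarrow> int" and B :: real
  assumes x: "\<And>n. 0 < x n" "\<And>n. x n < 1"
    and step: "\<And>n. 1 / x n = real_of_int (a n) + x (Suc n)"
    and a: "\<And>n. 1 \<le> a n" "\<And>n. real_of_int (a n) \<le> B"
    and "0 \<le> \<theta>" "\<theta> \<le> 1" "1 \<le> q" "0 \<le> p"
  shows "(1 + x n * \<theta>) / (2 * (B + 1))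
    \<le> \<bar>real_of_int q * x n - real_of_int p\<bar> * (real_of_int q + \<theta> * real_of_int p)"
  using assms(6-9)
proof (induction "nat q" arbitrary: n \<theta> q p rule: less_induct)
  case less
  have B1: "1 \<le> B" using a[of n] by linarith
  have x_lower: "1 / (B + 1) \<le> x k" for k
  proof -
    have "1 / x k \<le> B + 1" using step[of k] a(2)[of k] x(2)[of "Suc k"] by linarith
    then show ?thesis using x(1)[of k] B1 by (simp add: field_simps)
  qed
  have "x n * \<theta> \<le> 1 * 1"
    using x less.prems by (intro mult_mono) (auto intro: less_imp_le)
  then have "(1 + x n * \<theta>) / (2 * (B + 1)) \<le> 2 / (2 * (B + 1))"
    using B1 by (intro divide_right_mono) auto
  also have "2 / (2 * (B + 1)) = 1 / (B + 1)"
    using B1 by (simp add: field_simps)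
  finally have crude: "(1 + x n * \<theta>) / (2 * (B + 1)) \<le> 1 / (B + 1)" .
  have weight_ge_q: "real_of_int q \<le> real_of_int q + \<theta> * real_of_int p"
    using less.prems by simp
  define y where "y = x (Suc n)"
  have xy: "x n * (real_of_int (a n) + y) = 1"
    using step[of n] x(1)[of n] by (simp add: y_def field_simps)
  have y: "0 < y" "y < 1" using x by (simp_all add: y_def)
  consider "p = 0" | "q \<le> p" | "0 < p" "p < q" "q < a n * p" | "0 < p" "p < q" "a n * p \<le> q"
    using less.prems by linarith
  then show ?case
  proof cases
    case 1
    have "1 * x n * 1 \<le> real_of_int q * x n * real_of_int q"
      using less.prems x(1)[of n] by (intro mult_mono) auto
    then have "1 / (B + 1) \<le> real_of_int q * x n * real_of_int q"
      using x_lower[of n] by simp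
    with crude show ?thesis using 1 x(1)[of n] less.prems by simp
  next
    case 2
    \<comment> \<open>If \<open>x n\<close> were close to 1, then \<open>x (Suc n) = 1 / x n - 1\<close> would be too close to 0.\<close>
    have "1 + 1 / (B + 1) \<le> 1 / x n"
      using step[of n] a(1)[of n] x_lower[of "Suc n"] by linarith
    then have "x n \<le> (B + 1) / (B + 2)"
      using x(1)[of n] B1 by (simp add: field_simps)
    then have "1 / (B + 2) \<le> 1 - x n" using B1 by (simp add: field_simps)
    moreover have "1 / (2 * (B + 1)) \<le> 1 / (B + 2)" using B1 by (simp add: field_simps)
    ultimately have gap: "1 / (2 * (B + 1)) \<le> 1 - x n" by linarith
    have "1 * (1 - x n) \<le> real_of_int q * (1 - x n)"
      using less.prems x(2)[of n] by (intro mult_right_mono) auto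
    moreover have "real_of_int q \<le> real_of_int p" using 2 by simp
    ultimately have left: "1 - x n \<le> \<bar>real_of_int q * x n - real_of_int p\<bar>"
      by (simp add: algebra_simps)
    have "x n * \<theta> \<le> 1 * \<theta>" using x(2)[of n] less.prems by (intro mult_right_mono) auto
    moreover have "\<theta> * 1 \<le> \<theta> * real_of_int p"
      using less.prems 2 by (intro mult_left_mono) auto
    ultimately have right: "1 + x n * \<theta> \<le> real_of_int q + \<theta> * real_of_int p"
      using less.prems(3) by (smt (verit) of_int_1_le_iff)
    have "1 / (2 * (B + 1)) * (1 + x n * \<theta>)
        \<le> \<bar>real_of_int q * x n - real_of_int p\<bar> * (real_of_int q + \<theta> * real_of_int p)"
      using gap left right x(1)[of n] less.prems by (intro mult_mono) auto
    then show ?thesis by simp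
  next
    case 3
    \<comment> \<open>The digit overshoots: \<open>p / q - x n\<close> is positive, with \<open>p / x n\<close> at least \<open>q + 1\<close>.\<close>
    have "real_of_int (q + 1) \<le> real_of_int (a n * p)" using 3 by (simp only: of_int_le_iff)
    moreover have "0 \<le> real_of_int p * y" using 3 y by simp
    ultimately have "1 \<le> real_of_int p * (real_of_int (a n) + y) - real_of_int q"
      by (simp add: algebra_simps)
    then have "x n * 1 \<le> x n * (real_of_int p * (real_of_int (a n) + y) - real_of_int q)"
      using x(1)[of n] by (intro mult_left_mono) auto
    also have "\<dots> = real_of_int p * (x n * (real_of_int (a n) + y)) - real_of_int q * x n"
      by (simp add: algebra_simps)
    finally have "x n \<le> \<bar>real_of_int q * x n - real_of_int p\<bar>"
      unfolding xy by simp
    moreover have "1 \<le> real_of_int q + \<theta> * real_of_int p"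
      using weight_ge_q less.prems(3) by (smt (verit) of_int_1_le_iff)
    ultimately have "x n * 1
        \<le> \<bar>real_of_int q * x n - real_of_int p\<bar> * (real_of_int q + \<theta> * real_of_int p)"
      using x(1)[of n] by (intro mult_mono) auto
    with crude x_lower[of n] show ?thesis by simp
  next
    case 4
    define s where "s = real_of_int (a n) + \<theta>"
    define r where "r = q - a n * p"
    have s: "1 \<le> s" using a(1)[of n] less.prems by (simp add: s_def)
    have IH: "(1 + y * (1 / s)) / (2 * (B + 1))
      \<le> \<bar>real_of_int p * y - real_of_int r\<bar> * (real_of_int p + 1 / s * real_of_int r)"
      unfolding y_def using 4 s less.prems by (intro less.hyps) (auto simp: r_def)
    \<comment> \<open>The three factors of the invariant before the step, expressed by those after it.\<close>
    have e1: "real_of_int q * x n - real_of_int p = x n * (real_of_int r - real_of_int p * y)"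
    proof -
      have "real_of_int p = real_of_int p * (x n * (real_of_int (a n) + y))"
        by (simp add: xy)
      then show ?thesis by (simp add: r_def algebra_simps)
    qed
    have e2: "real_of_int q + \<theta> * real_of_int p = s * (real_of_int p + 1 / s * real_of_int r)"
      using s by (simp add: r_def s_def field_simps)
    have e3: "1 + x n * \<theta> = x n * s * (1 + y * (1 / s))"
    proof -
      have "x n * s * (1 + y * (1 / s)) = x n * (s + y)" using s by (simp add: field_simps)
      also have "\<dots> = x n * (real_of_int (a n) + y) + x n * \<theta>"
        by (simp add: s_def algebra_simps)
      finally show ?thesis by (simp add: xy)
    qed
    have "(1 + x n * \<theta>) / (2 * (B + 1)) = x n * s * ((1 + y * (1 / s)) / (2 * (B + 1)))"
      by (simp add: e3)
    also have "\<dots> \<le> x n * s * (\<bar>real_of_int p * y - real_of_int r\<bar>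
        * (real_of_int p + 1 / s * real_of_int r))"
      using x(1)[of n] s by (intro mult_left_mono[OF IH]) auto
    also have "\<dots> = \<bar>real_of_int q * x n - real_of_int p\<bar>
        * (real_of_int q + \<theta> * real_of_int p)"
      using x(1)[of n] unfolding e1 e2 by (simp add: abs_mult abs_minus_commute)
    finally show ?thesis .
  qed
qed

lemma complete_quotient_irrational:
  assumes "\<xi> \<notin> \<rat>"
  shows "complete_quotient \<xi> n \<notin> \<rat>"
proof (induction n)
  case (Suc n)
  have "frac (complete_quotient \<xi> n) \<notin> \<rat>"
    using Suc by (metis Rats_add Rats_of_int diff_add_cancel frac_def)
  then show ?case
    by (metis Rats_divide Rats_1 complete_quotient.simps(2) div_by_1 divide_divide_eq_right mult_1)
qed (use assms in simp)

text \<open>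
  The integer part of \<open>\<xi>\<close> does not affect the fractional part of \<open>q * \<xi>\<close>, so the orbit may start
  at \<open>frac \<xi>\<close>; the digits are then the partial quotients from index 1 on.
\<close>

lemma badly_approximable_imp_lower_bound:
  assumes "badly_approximable \<xi>"
  obtains \<kappa> where "0 < \<kappa>" "\<And>q::nat. 1 \<le> q \<Longrightarrow> \<kappa> \<le> real q * frac (real q * \<xi>)"
proof -
  obtain B where irr: "\<xi> \<notin> \<rat>" and B: "\<And>n. partial_quotient \<xi> n \<le> B"
    using assms by (auto simp: badly_approximable_def)
  define x where "x = (\<lambda>n. frac (complete_quotient \<xi> n))"
  define a where "a = (\<lambda>n. partial_quotient \<xi> (Suc n))"
  have x0: "0 < x n" for n
    using complete_quotient_irrational[OF irr, of n] Ints_subset_Rats by (auto simp: x_def)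
  have x1: "x n < 1" for n by (simp add: x_def frac_lt_1)
  have step: "1 / x n = real_of_int (a n) + x (Suc n)" for n
    by (simp add: x_def a_def partial_quotient_def frac_def)
  have a1: "1 \<le> a n" for n
    using x0[of n] x1[of n] by (simp add: a_def x_def partial_quotient_def le_floor_iff)
  have aB: "real_of_int (a n) \<le> real_of_int B" for n using B by (simp add: a_def)
  have B1: "1 \<le> B" using a1[of 0] B[of 1] by (simp add: a_def)
  show thesis
  proof (rule that)
    show "0 < 1 / (2 * (real_of_int B + 1))" using B1 by simp
    fix q :: nat
    assume q: "1 \<le> q"
    define p where "p = \<lfloor>real q * x 0\<rfloor>"
    have "real q * \<xi> = real q * x 0 + of_int (int q * \<lfloor>\<xi>\<rfloor>)"
      by (simp add: x_def frac_def algebra_simps)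
    then have fr: "frac (real q * \<xi>) = frac (real q * x 0)"
      by (simp only: frac_add_of_int_right)
    have "0 \<le> p" using x0[of 0] by (simp add: p_def)
    then have "(1 + x 0 * 0) / (2 * (real_of_int B + 1))
      \<le> \<bar>real_of_int (int q) * x 0 - real_of_int p\<bar> * (real_of_int (int q) + 0 * real_of_int p)"
      using q by (intro Gauss_map_orbit_lower_bound[of x a] x0 x1 step a1 aB) auto
    moreover have "real_of_int (int q) * x 0 - real_of_int p = frac (real q * \<xi>)"
      by (simp only: fr) (simp add: p_def frac_def)
    ultimately show "1 / (2 * (real_of_int B + 1)) \<le> real q * frac (real q * \<xi>)"
      by (simp add: mult.commute)
  qed
qed

section \<open>Growth of the maximal chain length\<close>

context irrational_log
begin

lemma max_chain_le_powr:
  assumes \<nu>: "irrationality_exponent (log (real b) c) < ereal \<nu>"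
  shows "\<exists>C. \<forall>q\<ge>1. ereal_of_enat (max_chain c b q) \<le> ereal (C * real q powr (\<nu> - 2))"
proof -
  obtain \<delta> where \<delta>: "0 < \<delta>" and bound:
    "\<And>p q. 1 \<le> q \<Longrightarrow> \<delta> * real q powr (- \<nu>) \<le> \<bar>log (real b) c - real_of_int p / real q\<bar>"
    using irrationality_exponent_imp_lower_bound[OF irrational \<nu>] by blast
  have "2 < ereal \<nu>"
    using irrationality_exponent_ge_2[OF irrational] \<nu> by (rule le_less_trans)
  then have \<nu>2: "2 < \<nu>" by simp
  define M where "M = (real b + 1) / ln (real b)"
  have M: "0 < M" using b_ge_2 by (simp add: M_def)
  have "ereal_of_enat (max_chain c b q) \<le> ereal ((3 + M / \<delta>) * real q powr (\<nu> - 2))"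
    if q: "1 \<le> q" for q
  proof -
    define \<beta> where "\<beta> = frac (real q * log (real b) c)"
    have \<beta>: "0 < \<beta>" using beta_coef_bounds[OF q] by (simp add: \<beta>_def beta_coef_def)
    have q0: "0 < real q" using q by simp
    \<comment> \<open>The approximation to test is the one from below, with numerator the floor of \<open>q * \<alpha>\<close>.\<close>
    have "log (real b) c - real_of_int \<lfloor>real q * log (real b) c\<rfloor> / real q = \<beta> / real q"
      using q0 by (simp add: \<beta>_def frac_def field_simps)
    then have "\<delta> * real q powr (- \<nu>) \<le> \<beta> / real q"
      using bound[OF q, of "\<lfloor>real q * log (real b) c\<rfloor>"] \<beta> by simp
    then have "\<delta> * real q powr (- \<nu>) * (real q)\<^sup>2 \<le> \<beta> / real q * (real q)\<^sup>2"
      by (intro mult_right_mono) auto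
    moreover have "real q powr (2 - \<nu>) = real q powr (- \<nu>) * (real q)\<^sup>2"
      using q0 by (simp add: powr_diff powr_minus field_simps powr_numeral)
    ultimately have "\<delta> * real q powr (2 - \<nu>) \<le> real q * \<beta>"
      using q0 by (simp add: power2_eq_square mult_ac)
    then have "M / (real q * \<beta>) \<le> M / (\<delta> * real q powr (2 - \<nu>))"
      using M \<delta> q0 by (intro divide_left_mono mult_pos_pos \<beta>) auto
    also have "\<dots> = M / \<delta> * real q powr (\<nu> - 2)"
      using q0 by (simp add: powr_diff field_simps)
    finally have "M / (real q * \<beta>) \<le> M / \<delta> * real q powr (\<nu> - 2)" .
    \<comment> \<open>Dirichlet's \<open>\<nu> > 2\<close> lets the growing factor absorb the additive constant.\<close>
    moreover have "1 \<le> real q powr (\<nu> - 2)"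
      using q \<nu>2 by (intro ge_one_powr_ge_zero) auto
    ultimately have "3 + M / (real q * \<beta>) \<le> (3 + M / \<delta>) * real q powr (\<nu> - 2)"
      by (simp add: algebra_simps)
    with max_chain_le_inverse_frac[OF q] show ?thesis
      unfolding M_def \<beta>_def by (meson ereal_less_eq(3) order_trans)
  qed
  then show ?thesis by blast
qed

lemma max_chain_bounded:
  assumes "badly_approximable (log (real b) c)"
  shows "(SUP q\<in>{1..}. max_chain c b q) < \<infinity>"
proof -
  obtain \<kappa> where \<kappa>: "0 < \<kappa>" and bound:
    "\<And>q::nat. 1 \<le> q \<Longrightarrow> \<kappa> \<le> real q * frac (real q * log (real b) c)"
    using badly_approximable_imp_lower_bound[OF assms] by blast
  define M where "M = (real b + 1) / ln (real b)"
  have M: "0 < M" using b_ge_2 by (simp add: M_def)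
  obtain N :: nat where N: "3 + M / \<kappa> \<le> real N" using real_arch_simple by blast
  have "max_chain c b q \<le> enat N" if q: "1 \<le> q" for q
  proof -
    have "M / (real q * frac (real q * log (real b) c)) \<le> M / \<kappa>"
      using bound[OF q] \<kappa> M by (intro divide_left_mono mult_pos_pos less_le_trans[OF \<kappa> bound[OF q]])
        auto
    then have "3 + M / (real q * frac (real q * log (real b) c)) \<le> real N"
      using N by simp
    then have "ereal_of_enat (max_chain c b q) \<le> ereal (real N)"
      using max_chain_le_inverse_frac[OF q] unfolding M_def
      by (meson ereal_less_eq(3) order_trans)
    then have "ereal_of_enat (max_chain c b q) \<le> ereal_of_enat (enat N)" by simp
    then show ?thesis by (simp only: ereal_of_enat_le_iff)
  qed
  then have "(SUP q\<in>{1..}. max_chain c b q) \<le> enat N" by (intro SUP_least) auto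
  also have "enat N < \<infinity>" by simp
  finally show ?thesis .
qed

end

text \<open>
  Only the statement about exponent 2 is left to derive: it is the general power bound at
  \<open>\<nu> = 2 + \<epsilon>\<close>.
\<close>

theorem theorem5p19:
  fixes b :: nat and c \<alpha> :: real
  assumes "b \<ge> 2" and "c > 1" and "\<alpha> = log (real b) c" and "\<alpha> \<notin> \<rat>"
  shows
    "(\<forall>q\<ge>1.
        W_len c b q = (t_coef c b q + 1) / (t_coef c b q - 1) \<and>
        (\<forall>m l. is_chain c b q m l \<longrightarrow>
           (\<forall>j. 1 \<le> j \<and> j + 2 \<le> l \<longrightarrow>
              real (m + j * q) \<in> I_int c b q \<and>
              \<lfloor>F_fun c b (m + (j + 1) * q)\<rfloor> - \<lfloor>F_fun c b (m + j * q)\<rfloor> = a_coef c b q) \<and>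
           (l \<ge> 3 \<longrightarrow>
              (real q - t_coef c b q) / (t_coef c b q - 1) < real m + real q \<and>
              real m + real q < (real q + 1) / (t_coef c b q - 1) - (real l - 3) * real q \<and>
              (real l - 3) * real q < W_len c b q) \<and>
           (int q \<le> (int b - 1) * int m - 1 \<longrightarrow>
              (l \<ge> 2 \<longrightarrow>
                 real m \<in> I_int c b q \<and>
                 \<lfloor>F_fun c b (m + q)\<rfloor> - \<lfloor>F_fun c b m\<rfloor> = a_coef c b q) \<and>
              int l \<le> 1 + \<lceil>W_len c b q / real q\<rceil>) \<and>
           (l \<ge> 4 \<and> (real l - 3) * real q > 1 \<longrightarrow>
              frac (real q * \<alpha>) < log (real b) (1 + 2 / ((real l - 3) * real q - 1)))) \<and>
        ereal_of_enat (max_chain c b q) \<le> ereal (2 + real_of_int \<lceil>W_len c b q / real q\<rceil>)) \<and>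
     (irrationality_exponent \<alpha> < \<infinity> \<longrightarrow>
        (\<forall>\<nu>::real. irrationality_exponent \<alpha> < ereal \<nu> \<longrightarrow>
           (\<exists>C::real. \<forall>q\<ge>1. ereal_of_enat (max_chain c b q) \<le> ereal (C * real q powr (\<nu> - 2))))) \<and>
     (irrationality_exponent \<alpha> = 2 \<longrightarrow>
        (\<forall>\<epsilon>::real. \<epsilon> > 0 \<longrightarrow>
           (\<exists>C::real. \<forall>q\<ge>1. ereal_of_enat (max_chain c b q) \<le> ereal (C * real q powr \<epsilon>)))) \<and>
     (badly_approximable \<alpha> \<longrightarrow> (SUP q\<in>{1..}. max_chain c b q) < \<infinity>)"
proof -
  interpret irrational_log b c
    using assms by unfold_locales auto
  note \<alpha> = \<open>\<alpha> = log (real b) c\<close>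
  have epsilon: "\<exists>C. \<forall>q\<ge>1. ereal_of_enat (max_chain c b q) \<le> ereal (C * real q powr \<epsilon>)"
    if "irrationality_exponent \<alpha> = 2" "0 < \<epsilon>" for \<epsilon> :: real
    using max_chain_le_powr[of "2 + \<epsilon>"] that by (simp add: \<alpha>)
  show ?thesis
    unfolding \<alpha>
    apply (intro conjI allI impI)
               apply (erule W_len_eq)
              apply (elim conjE, rule later_edge_principal; assumption)
             apply (elim conjE, rule later_edge_principal; assumption)
            apply (rule chain_position; assumption)
           apply (rule chain_position; assumption)
          apply (rule chain_position; assumption)
         apply (rule first_edge_principal; assumption)
        apply (rule first_edge_principal; assumption)
       apply (rule chain_length_le_of_first_edge; assumption)
      apply (elim conjE, rule long_chain_forces_small_frac; assumption)
     apply (erule max_chain_le_ceiling)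
    apply (erule max_chain_le_powr)
    apply (rule epsilon[unfolded \<alpha>]; assumption)
    apply (erule max_chain_bounded)
    done
qed

end
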